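(* Let $a>0$ be a fixed real number. As $s\to 0^+$, $$\Gamma(-s,as) := \int_{as}^\infty t^{-s-1} e^{-t}\, dt = -\log (as) -\gamma+s \Big[ \tfrac12 (\log (as))^2 + a -c_1 \Big] + O\big(s^2 |\log(as)|^3\big),$$ where $c_1$ is the constant (independent of $a$) given by $$c_1=\lim_{s\to 0^+}\Big(\int_s^\infty t^{-s-1}e^{-t}(\log t)\,dt+\tfrac12(\log s)^2\Big).$$
   Context: $\gamma$ is Euler's constant; $\Gamma(z,x)=\int_x^\infty t^{z-1}e^{-t}dt$ is the incomplete Gamma function. *)

theory Defs
  imports "HOL-Analysis.Analysis" "HOL-Library.Landau_Symbols"
begin

definition upper_incomplete_Gamma :: "real \<Rightarrow> real \<Rightarrow> real" where
  "upper_incomplete_Gamma z x = (LBINT t:{x..}. t powr (z - 1) * exp (- t))"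

definition c1_approx :: "real \<Rightarrow> real" where
  "c1_approx s = (LBINT t:{s..}. t powr (- s - 1) * exp (- t) * ln t) + 1 / 2 * (ln s)\<^sup>2"

(* Lim yields an unspecified value for a divergent argument, so convergence of c1_approx
   has to be asserted separately wherever c1 is used. *)
definition c1 :: real where
  "c1 = Lim (at_right 0) c1_approx"

end

theory Submission
  imports Defs "HOL-Real_Asymp.Real_Asymp"
begin

text \<open>
  Write \<open>x\<close> for the lower limit \<open>a s\<close>, and let \<open>E(x)\<close>, \<open>\<Lambda>(x)\<close> and \<open>T(x)\<close> be the integrals over
  \<open>t \<ge> x\<close> of \<open>exp (- t) / t\<close> multiplied by \<open>1\<close>, \<open>ln t\<close> and \<open>(ln t)^2\<close>. For \<open>t \<ge> x\<close> and \<open>x < 1\<close>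
  both \<open>1\<close> and \<open>t powr (- s)\<close> are at most \<open>x powr (- s)\<close>, so expanding \<open>t powr (- s)\<close> to first order
  in \<open>s\<close> under the integral gives
  \<open>\<Gamma>(-s, x) = E(x) - s \<Lambda>(x)\<close> up to \<open>s^2 x powr (- s) T(x)\<close> (\<open>log_tail_exponent_expansion\<close>).
  For \<open>x = a s\<close> the factor \<open>x powr (- s)\<close> tends to \<open>1\<close>, and \<open>T(x)\<close> is of order \<open>\<bar>ln x\<bar>^3\<close>
  (\<open>log_squared_tail_bound\<close>); this is the error term of the theorem.

  Integration by parts (\<open>log_tail_by_parts\<close>) shows that \<open>E(x) + ln x - x\<close> and
  \<open>\<Lambda>(x) + (ln x)^2 / 2\<close> have limits at \<open>0\<close>, namely the integral of \<open>ln t exp (- t)\<close> and half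
  that of \<open>(ln t)^2 exp (- t)\<close> over the positive half-line. The first of these is
  \<open>\<Gamma>'(1) = - \<gamma>\<close> (\<open>integral_ln_exp\<close>); the second is \<open>c1\<close>, since for \<open>x = s\<close> replacing
  \<open>t powr (- s)\<close> by \<open>1\<close> costs only \<open>s x powr (- s) T(x)\<close>, which tends to \<open>0\<close>
  (\<open>c1_approx_tendsto\<close>). The derivatives of the two functions are explicit, and bounding them near \<open>0\<close>
  bounds the distance of the functions to their limits by \<open>x^2 / 2\<close> and \<open>x - x ln x\<close>. The summand \<open>x = a s\<close>
  that is split off from \<open>E(x)\<close> is the source of the term \<open>a s\<close> in the expansion.
\<close>

section \<open>Integrals over half-lines\<close>

definition tail :: "(real \<Rightarrow> real) \<Rightarrow> real \<Rightarrow> real" where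
  "tail f x = (LBINT t:{x..}. f t)"

lemma tail_split:
  fixes f :: "real \<Rightarrow> real"
  assumes int: "set_integrable lborel {p..} f" and "p \<le> x"
  shows "tail f x = tail f p - integral {p..x} f"
proof -
  have intx: "set_integrable lborel {x..} f" and intpx: "set_integrable lborel {p..x} f"
    using assms by (auto intro: set_integrable_subset[OF int])
  have "(f has_integral (tail f p)) {p..}" "(f has_integral (tail f x)) {x..}"
    unfolding tail_def
    using set_borel_integral_eq_integral[OF int] set_borel_integral_eq_integral[OF intx]
    by (simp_all add: has_integral_integral)
  moreover have "(f has_integral (integral {p..x} f)) {p..x}"
    using set_borel_integral_eq_integral[OF intpx] by (simp add: has_integral_integral)
  moreover have "{p..x} \<inter> {x..} = {x}" "{p..x} \<union> {x..} = {p..}"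
    using assms(2) by auto
  ultimately have "(f has_integral (integral {p..x} f + tail f x)) {p..}"
    using has_integral_Un[of f "integral {p..x} f" "{p..x}" "tail f x" "{x..}"] by simp
  with \<open>(f has_integral (tail f p)) {p..}\<close> have "tail f p = integral {p..x} f + tail f x"
    by (rule has_integral_unique)
  thus ?thesis by simp
qed

lemma has_real_derivative_tail:
  fixes f :: "real \<Rightarrow> real"
  assumes cont: "continuous_on {0<..} f"
    and int: "\<And>x. x > 0 \<Longrightarrow> set_integrable lborel {x..} f" and x: "x > 0"
  shows "(tail f has_real_derivative - f x) (at x)"
proof -
  let ?I = "{x/2..x+1}"
  have "((\<lambda>y. integral {x/2..y} f) has_real_derivative f x) (at x within ?I)"
    using x by (intro integral_has_real_derivative continuous_on_subset[OF cont]) auto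
  hence "((\<lambda>y. tail f (x/2) - integral {x/2..y} f) has_real_derivative 0 - f x) (at x within ?I)"
    by (intro derivative_intros)
  hence "(tail f has_real_derivative - f x) (at x within ?I)"
    unfolding diff_0
  proof (rule has_field_derivative_transform_within[OF _ zero_less_one])
    fix y assume "y \<in> ?I"
    thus "tail f (x/2) - integral {x/2..y} f = tail f y"
      using tail_split[OF int[of "x/2"], of y] x by simp
  qed (use x in auto)
  moreover have "at x within ?I = at x"
    using x by (intro at_within_interior) auto
  ultimately show ?thesis by simp
qed

lemma tail_at_right_0:
  fixes f :: "real \<Rightarrow> real"
  assumes "set_integrable lborel {0<..} f"
  shows "(tail f \<longlongrightarrow> (LBINT t:{0<..}. f t)) (at_right 0)"
proof (rule tendsto_at_right_sequentially[of 0 1])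
  fix S :: "nat \<Rightarrow> real"
  assume S: "\<And>n. 0 < S n" "decseq S" "S \<longlonglongrightarrow> 0"
  have eq: "(\<Union>n. {S n..}) = {0<..}"
  proof safe
    fix x n assume "x \<ge> S n" thus "x > 0" using S(1)[of n] by simp
  next
    fix x :: real assume "x > 0"
    hence "eventually (\<lambda>n. S n < x) sequentially" using S(3) by (intro order_tendstoD(2))
    thus "x \<in> (\<Union>n. {S n..})" by (auto simp: eventually_sequentially intro: less_imp_le)
  qed
  have "(\<lambda>n. LBINT t:{S n..}. f t) \<longlonglongrightarrow> (LBINT t:(\<Union>n. {S n..}). f t)"
    by (rule set_integral_cont_up)
       (use assms S in \<open>auto simp: eq incseq_def decseq_def intro: order_trans\<close>)
  thus "(\<lambda>n. tail f (S n)) \<longlonglongrightarrow> (LBINT t:{0<..}. f t)" by (simp add: eq tail_def)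
qed simp

lemma tail_at_top:
  fixes f :: "real \<Rightarrow> real"
  assumes int: "set_integrable lborel {p..} f"
  shows "(tail f \<longlongrightarrow> 0) at_top"
proof -
  have *: "(\<lambda>t. indicator {p..} t * f t) \<in> borel_measurable lborel"
    using int by (simp add: set_integrable_def borel_measurable_integrable)
  have "((\<lambda>x. LINT t|lborel. indicator {x..} t * (indicator {p..} t * f t)) \<longlongrightarrow>
          (LINT t::real|lborel. (0::real))) at_top"
  proof (rule integral_dominated_convergence_at_top[where w = "\<lambda>t. \<bar>indicator {p..} t * f t\<bar>"])
    show "integrable lborel (\<lambda>t. \<bar>indicator {p..} t * f t\<bar>)"
      using int by (auto simp: set_integrable_def)
    show "AE t in lborel. ((\<lambda>x. indicator {x..} t * (indicator {p..} t * f t)) \<longlongrightarrow> 0) at_top"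
    proof (rule AE_I2)
      fix t :: real
      have "eventually (\<lambda>x. indicator {x..} t * (indicator {p..} t * f t) = 0) at_top"
        using eventually_gt_at_top[of t] by eventually_elim (auto simp: indicator_def)
      thus "((\<lambda>x. indicator {x..} t * (indicator {p..} t * f t)) \<longlongrightarrow> 0) at_top"
        by (rule tendsto_eventually)
    qed
    show "(\<lambda>t. indicator {x..} t * (indicator {p..} t * f t)) \<in> borel_measurable lborel" for x
      by (intro borel_measurable_times *) auto
  qed (auto simp: indicator_def)
  moreover have "eventually (\<lambda>x. (LINT t|lborel. indicator {x..} t * (indicator {p..} t * f t)) = tail f x) at_top"
    using eventually_ge_at_top[of p]
  proof eventually_elim
    case (elim x)
    thus ?case unfolding tail_def set_lebesgue_integral_def
      by (intro Bochner_Integration.integral_cong) (auto simp: indicator_def)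
  qed
  ultimately show ?thesis by (simp add: tendsto_cong)
qed

text \<open>
  The difference of the two sides has derivative \<open>0\<close> on the positive half-line, hence is
  constant, and each of its terms vanishes at infinity.
\<close>

lemma tail_by_parts:
  fixes g g' :: "real \<Rightarrow> real"
  assumes deriv: "\<And>x. x > 0 \<Longrightarrow> (g has_real_derivative g' x) (at x)"
    and cont: "continuous_on {0<..} g'"
    and int: "\<And>x. x > 0 \<Longrightarrow> set_integrable lborel {x..} (\<lambda>t. g t * exp (- t))"
    and int': "\<And>x. x > 0 \<Longrightarrow> set_integrable lborel {x..} (\<lambda>t. g' t * exp (- t))"
    and lim: "((\<lambda>x. g x * exp (- x)) \<longlongrightarrow> 0) at_top" and x: "x > 0"
  shows "tail (\<lambda>t. g' t * exp (- t)) x = tail (\<lambda>t. g t * exp (- t)) x - g x * exp (- x)"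
proof -
  define D where "D = (\<lambda>x. tail (\<lambda>t. g' t * exp (- t)) x - tail (\<lambda>t. g t * exp (- t)) x + g x * exp (- x))"
  have contg: "continuous_on {0<..} g"
    by (auto intro!: DERIV_continuous_on[of _ _ g'] has_field_derivative_at_within deriv)
  have "\<exists>c. \<forall>x\<in>{0<..}. D x = c"
  proof (rule has_field_derivative_zero_constant)
    fix x :: real assume "x \<in> {0<..}"
    hence "(D has_real_derivative 0) (at x)"
      unfolding D_def
      by (auto intro!: derivative_eq_intros has_real_derivative_tail continuous_intros cont contg int int' deriv)
    thus "(D has_real_derivative 0) (at x within {0<..})" by (rule has_field_derivative_at_within)
  qed auto
  then obtain c where c: "\<And>x. x > 0 \<Longrightarrow> D x = c" by auto
  have "(D \<longlongrightarrow> 0 - 0 + 0) at_top"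
    unfolding D_def by (intro tendsto_intros tail_at_top[of 1] int int' lim) auto
  moreover have "(D \<longlongrightarrow> c) at_top"
    by (intro tendsto_eventually eventually_mono[OF eventually_gt_at_top[of 0]] c)
  ultimately have "c = 0" using tendsto_unique[OF trivial_limit_at_top_linorder] by fastforce
  thus ?thesis using c[OF x] by (simp add: D_def)
qed

text \<open>
  Both \<open>g + (f - l)\<close> and \<open>g - (f - l)\<close> are nondecreasing and tend to \<open>0\<close> at \<open>0\<close>, hence are
  nonnegative. This turns a bound on a derivative into a rate of convergence.
\<close>

lemma bound_by_derivative_at_right_0:
  fixes f g f' g' :: "real \<Rightarrow> real"
  assumes f: "(f \<longlongrightarrow> l) (at_right 0)" and g: "(g \<longlongrightarrow> 0) (at_right 0)"
    and f': "\<And>x. x \<in> {0<..<b} \<Longrightarrow> (f has_real_derivative f' x) (at x)"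
    and g': "\<And>x. x \<in> {0<..<b} \<Longrightarrow> (g has_real_derivative g' x) (at x)"
    and le: "\<And>x. x \<in> {0<..<b} \<Longrightarrow> \<bar>f' x\<bar> \<le> g' x" and x: "x \<in> {0<..<b}"
  shows "\<bar>f x - l\<bar> \<le> g x"
proof -
  have key: "0 \<le> g x + \<sigma> * (f x - l)" if "\<bar>\<sigma>\<bar> = 1" for \<sigma> :: real
  proof (rule tendsto_upperbound)
    have "((\<lambda>y. g y + \<sigma> * (f y - l)) \<longlongrightarrow> 0 + \<sigma> * (l - l)) (at_right 0)"
      by (intro tendsto_intros f g)
    thus "((\<lambda>y. g y + \<sigma> * (f y - l)) \<longlongrightarrow> 0) (at_right 0)" by simp
    have "g y + \<sigma> * (f y - l) \<le> g x + \<sigma> * (f x - l)" if "y \<in> {0<..<x}" for y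
    proof (rule DERIV_nonneg_imp_nondecreasing[where f = "\<lambda>y. g y + \<sigma> * (f y - l)"])
      fix z assume "y \<le> z" "z \<le> x"
      hence z: "z \<in> {0<..<b}" using x that by auto
      have "((\<lambda>y. g y + \<sigma> * (f y - l)) has_real_derivative g' z + \<sigma> * f' z) (at z)"
        by (auto intro!: derivative_eq_intros f' g' z)
      moreover have "\<bar>\<sigma> * f' z\<bar> \<le> g' z" using le[OF z] \<open>\<bar>\<sigma>\<bar> = 1\<close> by (simp add: abs_mult)
      hence "0 \<le> g' z + \<sigma> * f' z" by linarith
      ultimately show "\<exists>d. ((\<lambda>y. g y + \<sigma> * (f y - l)) has_real_derivative d) (at z) \<and> 0 \<le> d"
        by blast
    qed (use that in auto)
    thus "\<forall>\<^sub>F y in at_right 0. g y + \<sigma> * (f y - l) \<le> g x + \<sigma> * (f x - l)"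
      using x by (auto simp: eventually_at_right_field)
  qed simp
  from key[of 1] key[of "-1"] show ?thesis by simp
qed

section \<open>Logarithmic moments of the exponential distribution\<close>

lemma set_integrable_Gamma:
  assumes "(x::real) > 0"
  shows "set_integrable lborel {0<..} (\<lambda>t. t powr (x - 1) * exp (- t))"
    and "(LBINT t:{0<..}. t powr (x - 1) * exp (- t)) = Gamma x"
proof -
  have "((\<lambda>t. t powr (x - 1) / exp t) has_integral Gamma x) {0<..}"
    using Gamma_integral_real[OF assms]
    by (rule has_integral_spike_set_eq[THEN iffD1, rotated 2])
       (auto intro: negligible_subset[of "{0}"])
  hence I: "((\<lambda>t. t powr (x - 1) * exp (- t)) has_integral Gamma x) {0<..}"
    by (simp add: exp_minus field_simps)
  hence "(\<lambda>t. t powr (x - 1) * exp (- t)) absolutely_integrable_on {0<..}"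
    by (intro nonnegative_absolutely_integrable_1) auto
  thus J: "set_integrable lborel {0<..} (\<lambda>t. t powr (x - 1) * exp (- t))"
    unfolding set_integrable_def
    by (subst (asm) integrable_completion) auto
  show "(LBINT t:{0<..}. t powr (x - 1) * exp (- t)) = Gamma x"
    using set_borel_integral_eq_integral(2)[OF J] I by (simp add: integral_unique)
qed

text \<open>
  The right-hand side is chosen so that its product with \<open>exp (- t)\<close> is a sum of two Gamma
  integrands.
\<close>

lemma ln_squared_le:
  assumes "(t::real) > 0"
  shows "(ln t)\<^sup>2 \<le> 32 * (t powr (1/2) + t powr (-1/2))"
proof -
  define u where "u = t powr (1/4)"
  have u: "u > 0" using assms by (simp add: u_def)
  have "ln t = 4 * ln u" using assms by (simp add: u_def ln_powr)
  moreover have "\<bar>ln u\<bar> \<le> u + 1/u"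
  proof -
    have "ln u \<le> u - 1" "ln (1/u) \<le> 1/u - 1" using u by (intro ln_le_minus_one; simp)+
    moreover have "ln (1/u) = - ln u" using u by (simp add: ln_div)
    moreover have "1/u > 0" using u by simp
    ultimately show ?thesis using u by linarith
  qed
  hence "\<bar>ln u\<bar>\<^sup>2 \<le> (u + 1/u)\<^sup>2" by (intro power_mono) auto
  moreover have "(u + 1/u)\<^sup>2 \<le> 2 * (u\<^sup>2 + 1/u\<^sup>2)"
    using sum_squares_bound[of u "1/u"] by (simp add: power2_sum power_divide)
  moreover have "u\<^sup>2 = t powr (1/2)" using assms by (simp add: u_def powr_power)
  moreover have "1/u\<^sup>2 = t powr (-1/2)"
    using assms by (simp add: u_def powr_power powr_minus field_simps)
  ultimately show ?thesis by (simp add: power_mult_distrib)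
qed

text \<open>
  This function dominates the integrands of the logarithmic moments of order at most two.
\<close>

lemma set_integrable_log_weight:
  "set_integrable lborel {0<..} (\<lambda>t::real. (1 + (ln t)\<^sup>2) * exp (- t))"
proof (rule set_integrable_bound)
  have "set_integrable lborel {0<..} (\<lambda>t. t powr (1 - 1) * exp (- t)
          + 32 * (t powr (3/2 - 1) * exp (- t) + t powr (1/2 - 1) * exp (- t)) :: real)"
    by (intro set_integral_add set_integrable_mult_right set_integrable_Gamma) auto
  thus "set_integrable lborel {0<..} (\<lambda>t. t powr (1 - 1) * exp (- t)
          + 32 * (t powr (3/2 - 1) * exp (- t) + t powr (1/2 - 1) * exp (- t)) :: real)" .
  show "set_borel_measurable lborel {0<..} (\<lambda>t::real. (1 + (ln t)\<^sup>2) * exp (- t))"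
    unfolding set_borel_measurable_def by measurable
  show "AE t in lborel. t \<in> {0<..} \<longrightarrow> norm ((1 + (ln t)\<^sup>2) * exp (- t))
          \<le> norm (t powr (1 - 1) * exp (- t)
          + 32 * (t powr (3/2 - 1) * exp (- t) + t powr (1/2 - 1) * exp (- t)) :: real)"
  proof (intro AE_I2 impI)
    fix t :: real assume "t \<in> {0<..}"
    hence t: "t > 0" by simp
    have "(1 + (ln t)\<^sup>2) * exp (- t) \<le> (1 + 32 * (t powr (1/2) + t powr (-1/2))) * exp (- t)"
      using ln_squared_le[OF t] by (intro mult_right_mono) auto
    also have "\<dots> = t powr (1 - 1) * exp (- t)
          + 32 * (t powr (3/2 - 1) * exp (- t) + t powr (1/2 - 1) * exp (- t))"
      using t by (simp add: algebra_simps)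
    finally show "norm ((1 + (ln t)\<^sup>2) * exp (- t)) \<le> norm (t powr (1 - 1) * exp (- t)
          + 32 * (t powr (3/2 - 1) * exp (- t) + t powr (1/2 - 1) * exp (- t)))"
      by (simp add: abs_mult)
  qed
qed

lemma set_integrable_log_bound:
  fixes h :: "real \<Rightarrow> real"
  assumes meas: "h \<in> borel_measurable borel" and S: "S \<in> sets borel" "S \<subseteq> {0<..}"
    and le: "\<And>t. t \<in> S \<Longrightarrow> \<bar>h t\<bar> \<le> C * (1 + (ln t)\<^sup>2)"
  shows "set_integrable lborel S (\<lambda>t. h t * exp (- t))"
proof (rule set_integrable_bound)
  show "set_integrable lborel S (\<lambda>t. C * ((1 + (ln t)\<^sup>2) * exp (- t)))"
    using S by (intro set_integrable_mult_right set_integrable_subset[OF set_integrable_log_weight]) auto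
  show "set_borel_measurable lborel S (\<lambda>t. h t * exp (- t))"
    unfolding set_borel_measurable_def using meas S by measurable
  show "AE t in lborel. t \<in> S \<longrightarrow> norm (h t * exp (- t)) \<le> norm (C * ((1 + (ln t)\<^sup>2) * exp (- t)))"
  proof (intro AE_I2 impI)
    fix t assume "t \<in> S"
    hence "\<bar>h t\<bar> * exp (- t) \<le> C * (1 + (ln t)\<^sup>2) * exp (- t)" by (intro mult_right_mono le) auto
    thus "norm (h t * exp (- t)) \<le> norm (C * ((1 + (ln t)\<^sup>2) * exp (- t)))"
      by (simp add: abs_mult order_trans[OF _ mult_right_mono[OF abs_ge_self]])
  qed
qed

lemma abs_ln_le: "\<bar>ln t\<bar> \<le> 1 + (ln t)\<^sup>2" for t :: real
proof -
  have "0 \<le> (\<bar>ln t\<bar> - 1)\<^sup>2" by simp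
  hence "2 * \<bar>ln t\<bar> \<le> 1 + (ln t)\<^sup>2" by (simp add: power2_diff)
  thus ?thesis by simp
qed

lemma set_integrable_log_moment:
  fixes x z :: real
  assumes "x > 0" "k \<le> 2" "z \<le> 0"
  shows "set_integrable lborel {x..} (\<lambda>t. t powr z * ln t ^ k * exp (- t))"
proof (rule set_integrable_log_bound[where C = "x powr z"])
  fix t assume t: "t \<in> {x..}"
  have "\<bar>ln t\<bar> ^ k \<le> 1 + (ln t)\<^sup>2"
    using assms(2) abs_ln_le[of t] by (auto simp: le_Suc_eq numeral_2_eq_2)
  moreover have "t powr z \<le> x powr z" using t assms by (intro powr_mono2') auto
  ultimately show "\<bar>t powr z * ln t ^ k\<bar> \<le> x powr z * (1 + (ln t)\<^sup>2)"
    by (auto simp: abs_mult power_abs intro!: mult_mono)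
qed (use assms in auto)

text \<open>
  Since \<open>exp u \<ge> 1 + u\<close>, integrating \<open>t powr h \<ge> 1 + h ln t\<close> against \<open>exp (- t)\<close> yields
  \<open>\<Gamma>(1 + h) \<ge> 1 + h A\<close> for \<open>\<bar>h\<bar> < 1\<close>, where \<open>A\<close> is the integral in question. Equality holds at
  \<open>h = 0\<close>, so the derivatives agree there: \<open>A = \<Gamma>'(1) = - \<gamma>\<close>. This avoids
  differentiating under the integral sign.
\<close>

lemma integral_ln_exp: "(LBINT t:{0<..}. ln t * exp (- t)) = (- euler_mascheroni :: real)"
proof -
  let ?A = "LBINT t:{0<..}. ln t * exp (- t) :: real"
  have intA: "set_integrable lborel {0<..} (\<lambda>t::real. ln t * exp (- t))"
    by (rule set_integrable_log_bound[where C = 1]) (auto simp: abs_ln_le)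
  define f where "f = (\<lambda>h::real. Gamma (1 + h) - 1 - h * ?A)"
  have f0: "f 0 \<le> f h" if h: "\<bar>0 - h\<bar> < 1" for h
  proof -
    note G = set_integrable_Gamma[of "1 + h"]
    have 1: "set_integrable lborel {0<..} (\<lambda>t::real. exp (- t))"
      "(LBINT t:{0<..}. exp (- t)) = (1::real)"
    proof -
      have "set_integrable lborel {0<..} (\<lambda>t::real. exp (- t)) \<longleftrightarrow>
          set_integrable lborel {0<..} (\<lambda>t::real. t powr (1 - 1) * exp (- t))"
        by (intro set_integrable_cong) auto
      thus "set_integrable lborel {0<..} (\<lambda>t::real. exp (- t))"
        using set_integrable_Gamma(1)[of 1] by simp
      have "(LBINT t:{0<..}. exp (- t)) = (LBINT t:{0<..}. t powr (1 - 1) * exp (- t) :: real)"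
        by (intro set_lebesgue_integral_cong) auto
      thus "(LBINT t:{0<..}. exp (- t)) = (1::real)"
        using set_integrable_Gamma(2)[of 1] by simp
    qed
    have "(LBINT t:{0<..}. exp (- t) + h * (ln t * exp (- t)))
            \<le> (LBINT t:{0<..}. t powr (1 + h - 1) * exp (- t))"
    proof (rule set_integral_mono)
      fix t :: real assume "t \<in> {0<..}"
      hence "1 + h * ln t \<le> t powr h"
        using exp_ge_add_one_self[of "h * ln t"] by (simp add: powr_def)
      hence "(1 + h * ln t) * exp (- t) \<le> t powr h * exp (- t)" by (intro mult_right_mono) auto
      thus "exp (- t) + h * (ln t * exp (- t)) \<le> t powr (1 + h - 1) * exp (- t)"
        by (simp add: algebra_simps)
    qed (use h G 1 intA in auto)
    also have "\<dots> = Gamma (1 + h)" using h G by simp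
    also have "(LBINT t:{0<..}. exp (- t) + h * (ln t * exp (- t))) = 1 + h * ?A"
      using 1 intA by (subst set_integral_add) auto
    finally show ?thesis by (simp add: f_def)
  qed
  have "(f has_real_derivative Gamma 1 * Digamma 1 - ?A) (at 0)"
    unfolding f_def
    by (auto intro!: derivative_eq_intros simp: nonpos_Ints_def)
  hence "Gamma 1 * Digamma 1 - ?A = 0"
    by (rule DERIV_local_min[where d = 1]) (use f0 in auto)
  thus ?thesis by simp
qed

section \<open>Tails of the logarithmic moments near zero\<close>

definition log_tail :: "real \<Rightarrow> nat \<Rightarrow> real \<Rightarrow> real" where
  "log_tail z k = tail (\<lambda>t. t powr z * ln t ^ k * exp (- t))"

lemma has_real_derivative_log_tail:
  assumes "x > 0" "k \<le> 2" "z \<le> 0"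
  shows "(log_tail z k has_real_derivative - (x powr z * ln x ^ k * exp (- x))) (at x)"
  unfolding log_tail_def
proof (rule has_real_derivative_tail)
  show "continuous_on {0<..} (\<lambda>t. t powr z * ln t ^ k * exp (- t))"
    by (intro continuous_intros) auto
qed (use assms set_integrable_log_moment in auto)

text \<open>
  Integrating \<open>ln t ^ k / t\<close> removes the singularity at \<open>0\<close>: what remains on the right is an integral
  that converges down to \<open>0\<close> and an explicit boundary term. The factor \<open>t powr 0\<close> in the proof equals
  \<open>1\<close> only for \<open>t \<noteq> 0\<close>.
\<close>

lemma log_tail_by_parts:
  assumes "x > 0" "k \<le> 1"
  shows "log_tail (-1) k x = (log_tail 0 (k + 1) x - ln x ^ (k + 1) * exp (- x)) / real (k + 1)"
proof -
  let ?g = "\<lambda>t::real. t powr 0 * ln t ^ (k + 1) / real (k + 1)"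
  let ?g' = "\<lambda>t::real. t powr (-1) * ln t ^ k"
  have int: "set_integrable lborel {x..} (\<lambda>t. ?g t * exp (- t))" if "x > 0" for x
  proof -
    have "set_integrable lborel {x..} (\<lambda>t. (1 / real (k + 1)) * (t powr 0 * ln t ^ (k + 1) * exp (- t)))"
      using that assms(2) by (intro set_integrable_mult_right set_integrable_log_moment) auto
    thus ?thesis by simp
  qed
  have "tail (\<lambda>t. ?g' t * exp (- t)) x = tail (\<lambda>t. ?g t * exp (- t)) x - ?g x * exp (- x)"
  proof (rule tail_by_parts)
    fix x :: real assume x: "x > 0"
    have "((\<lambda>t. ln t ^ (k + 1) / real (k + 1)) has_real_derivative ?g' x) (at x)"
    proof -
      consider "k = 0" | "k = 1" using assms(2) by linarith
      thus ?thesis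
        by cases (use x in \<open>auto intro!: derivative_eq_intros simp: powr_minus field_simps\<close>)
    qed
    thus "(?g has_real_derivative ?g' x) (at x)"
      by (rule has_field_derivative_transform_within_open[of _ _ _ "{0<..}"]) (use x in auto)
    show "set_integrable lborel {x..} (\<lambda>t. ?g' t * exp (- t))"
      using x assms(2) by (intro set_integrable_log_moment) auto
    show "set_integrable lborel {x..} (\<lambda>t. ?g t * exp (- t))"
      using x by (rule int)
  next
    have "((\<lambda>x::real. ln x ^ (k + 1) / real (k + 1) * exp (- x)) \<longlongrightarrow> 0) at_top"
    proof -
      consider "k = 0" | "k = 1" using assms(2) by linarith
      thus ?thesis by cases (simp, real_asymp)+
    qed
    moreover have "eventually (\<lambda>x. ln x ^ (k + 1) / real (k + 1) * exp (- x) = ?g x * exp (- x)) at_top"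
      using eventually_gt_at_top[of 0] by eventually_elim simp
    ultimately show "((\<lambda>x. ?g x * exp (- x)) \<longlongrightarrow> 0) at_top"
      by (rule Lim_transform_eventually)
    show "continuous_on {0<..} ?g'"
      by (intro continuous_intros) auto
  qed (use assms(1) in simp)
  moreover have "tail (\<lambda>t. ?g t * exp (- t)) x = tail (\<lambda>t. (t powr 0 * ln t ^ (k + 1) * exp (- t)) / real (k + 1)) x"
    by simp
  moreover have "\<dots> = log_tail 0 (k + 1) x / real (k + 1)"
    unfolding log_tail_def tail_def by (rule set_integral_divide_zero)
  ultimately show ?thesis using assms(1) by (simp add: log_tail_def diff_divide_distrib)
qed

text \<open>
  By parts, the function is \<open>(log_tail 0 (k + 1) x + ln x ^ (k + 1) (1 - exp (- x))) / (k + 1)\<close>,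
  where the second summand tends to \<open>0\<close>.
\<close>

lemma log_tail_at_right_0:
  assumes "k \<le> 1"
  shows "((\<lambda>x. log_tail (-1) k x + ln x ^ (k + 1) / real (k + 1)) \<longlongrightarrow>
           (LBINT t:{0<..}. ln t ^ (k + 1) * exp (- t)) / real (k + 1)) (at_right 0)"
proof -
  let ?I = "LBINT t:{0<..}. ln t ^ (k + 1) * exp (- t) :: real"
  have 1: "set_integrable lborel {0<..} (\<lambda>t::real. t powr 0 * ln t ^ (k + 1) * exp (- t))"
  proof (rule set_integrable_log_bound[where C = 1])
    fix t :: real assume "t \<in> {0<..}"
    thus "\<bar>t powr 0 * ln t ^ (k + 1)\<bar> \<le> 1 * (1 + (ln t)\<^sup>2)"
      using assms abs_ln_le[of t] by (auto simp: le_Suc_eq numeral_2_eq_2)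
  qed auto
  have 2: "(LBINT t:{0<..}. t powr 0 * ln t ^ (k + 1) * exp (- t)) = ?I"
    by (intro set_lebesgue_integral_cong) auto
  have "((\<lambda>x::real. ln x ^ (k + 1) * (1 - exp (- x))) \<longlongrightarrow> 0) (at_right 0)"
  proof -
    consider "k = 0" | "k = 1" using assms by linarith
    thus ?thesis by cases (simp, real_asymp)+
  qed
  with tail_at_right_0[OF 1] have "((\<lambda>x. (log_tail 0 (k + 1) x + ln x ^ (k + 1) * (1 - exp (- x))) / real (k + 1))
          \<longlongrightarrow> (?I + 0) / real (k + 1)) (at_right 0)"
    unfolding log_tail_def 2 by (intro tendsto_intros) auto
  moreover have "eventually (\<lambda>x. (log_tail 0 (k + 1) x + ln x ^ (k + 1) * (1 - exp (- x))) / real (k + 1)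
       = log_tail (-1) k x + ln x ^ (k + 1) / real (k + 1)) (at_right 0)"
    using eventually_at_right_less[of "0::real"]
    by eventually_elim (use assms in \<open>simp add: log_tail_by_parts diff_divide_distrib add_divide_distrib right_diff_distrib\<close>)
  ultimately show ?thesis unfolding add_0_right by (rule Lim_transform_eventually)
qed

text \<open>
  The linear term has to be split off: without it the error would be of order \<open>x\<close>, which for
  \<open>x = a s\<close> exceeds the error allowed in the theorem. The derivative of what is left is
  \<open>(1 - exp (- x) - x) / x\<close>, of absolute value at most \<open>x\<close>.
\<close>

lemma exponential_integral_bound:
  assumes "0 < x" "x < 1"
  shows "\<bar>log_tail (-1) 0 x + ln x - x + euler_mascheroni\<bar> \<le> x\<^sup>2 / 2"
proof -
  have "\<bar>(log_tail (-1) 0 x + ln x - x) - (- euler_mascheroni - 0)\<bar> \<le> x\<^sup>2 / 2"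
  proof (rule bound_by_derivative_at_right_0
      [where b = 1 and f = "\<lambda>x. log_tail (-1) 0 x + ln x - x" and g = "\<lambda>x. x\<^sup>2 / 2"])
    show "((\<lambda>x. log_tail (-1) 0 x + ln x - x) \<longlongrightarrow> - euler_mascheroni - 0) (at_right 0)"
      using log_tail_at_right_0[of 0] by (intro tendsto_intros) (simp add: integral_ln_exp)
    show "((\<lambda>x::real. x\<^sup>2 / 2) \<longlongrightarrow> 0) (at_right 0)" by real_asymp
    fix y :: real assume y: "y \<in> {0<..<1}"
    show "((\<lambda>x. log_tail (-1) 0 x + ln x - x) has_real_derivative
             - (y powr (-1) * ln y ^ 0 * exp (- y)) + 1 / y - 1) (at y)"
      using y by (auto intro!: derivative_eq_intros has_real_derivative_log_tail)
    show "((\<lambda>x. x\<^sup>2 / 2) has_real_derivative y) (at y)"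
      by (auto intro!: derivative_eq_intros)
    have "exp (- y) * (1 + y) \<le> 1"
      using exp_ge_add_one_self[of y] by (simp add: exp_minus field_simps)
    also have "1 \<le> (1 - y + y * y) * (1 + y)" using y by (simp add: algebra_simps)
    finally have "exp (- y) \<le> 1 - y + y * y"
      by (rule mult_right_le_imp_le) (use y in simp)
    moreover have "1 - y \<le> exp (- y)" using exp_ge_add_one_self[of "-y"] by linarith
    ultimately have "\<bar>1 - exp (- y) - y\<bar> \<le> y * y" by linarith
    hence "\<bar>(1 - exp (- y) - y) / y\<bar> \<le> y"
      using y by (simp add: abs_divide pos_divide_le_eq)
    moreover have "- (y powr (-1) * ln y ^ 0 * exp (- y)) + 1 / y - 1 = (1 - exp (- y) - y) / y"
      using y by (simp add: powr_minus field_simps)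
    ultimately show "\<bar>- (y powr (-1) * ln y ^ 0 * exp (- y)) + 1 / y - 1\<bar> \<le> y"
      by (simp only:)
  qed (use assms in auto)
  thus ?thesis by simp
qed

text \<open>
  Here an error of order \<open>x \<bar>ln x\<bar>\<close> is good enough, as this integral enters the expansion with
  a factor \<open>s\<close>. The derivative is \<open>ln x (1 - exp (- x)) / x\<close>, of absolute value at most
  \<open>- ln x\<close>.
\<close>

lemma log_exponential_integral_bound:
  assumes "0 < x" "x < 1"
  shows "\<bar>log_tail (-1) 1 x + (ln x)\<^sup>2 / 2 - (LBINT t:{0<..}. (ln t)\<^sup>2 * exp (- t)) / 2\<bar>
           \<le> x - x * ln x"
proof (rule bound_by_derivative_at_right_0
    [where b = 1 and f = "\<lambda>x. log_tail (-1) 1 x + (ln x)\<^sup>2 / 2" and g = "\<lambda>x. x - x * ln x"])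
  show "((\<lambda>x. log_tail (-1) 1 x + (ln x)\<^sup>2 / 2) \<longlongrightarrow>
          (LBINT t:{0<..}. (ln t)\<^sup>2 * exp (- t)) / 2) (at_right 0)"
    using log_tail_at_right_0[of 1] by (simp add: numeral_2_eq_2)
  show "((\<lambda>x::real. x - x * ln x) \<longlongrightarrow> 0) (at_right 0)" by real_asymp
  fix y :: real assume y: "y \<in> {0<..<1}"
  show "((\<lambda>x. log_tail (-1) 1 x + (ln x)\<^sup>2 / 2) has_real_derivative
           - (y powr (-1) * ln y ^ 1 * exp (- y)) + ln y / y) (at y)"
    using y by (auto intro!: derivative_eq_intros has_real_derivative_log_tail)
  show "((\<lambda>x. x - x * ln x) has_real_derivative - ln y) (at y)"
    using y by (auto intro!: derivative_eq_intros)
  have "- (y powr (-1) * ln y ^ 1 * exp (- y)) + ln y / y = ln y * ((1 - exp (- y)) / y)"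
    using y by (simp add: powr_minus field_simps)
  moreover have "0 \<le> (1 - exp (- y)) / y" "(1 - exp (- y)) / y \<le> 1"
    using y exp_ge_add_one_self[of "-y"] by (simp_all add: pos_divide_le_eq)
  hence "\<bar>ln y * ((1 - exp (- y)) / y)\<bar> \<le> \<bar>ln y\<bar> * 1"
    unfolding abs_mult by (intro mult_left_mono) auto
  moreover have "ln y \<le> 0" using y by simp
  ultimately show "\<bar>- (y powr (-1) * ln y ^ 1 * exp (- y)) + ln y / y\<bar> \<le> - ln y"
    by linarith
qed (use assms in auto)

text \<open>
  The function \<open>log_tail (-1) 2 x + ln x ^ 3 / 3\<close> has the nonnegative derivative
  \<open>(ln x)^2 (1 - exp (- x)) / x\<close>, so it is largest at \<open>1\<close>.
\<close>

lemma log_squared_tail_bound: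
  assumes "0 < x" "x < 1"
  shows "log_tail (-1) 2 x \<le> log_tail (-1) 2 1 - ln x ^ 3 / 3"
proof -
  have "log_tail (-1) 2 x + ln x ^ 3 / 3 \<le> log_tail (-1) 2 1 + ln 1 ^ 3 / 3"
  proof (rule DERIV_nonneg_imp_nondecreasing[where f = "\<lambda>x. log_tail (-1) 2 x + ln x ^ 3 / 3"])
    fix y assume "x \<le> y" "y \<le> 1"
    hence y: "y > 0" using assms by simp
    have "((\<lambda>x. log_tail (-1) 2 x + ln x ^ 3 / 3) has_real_derivative
             - (y powr (-1) * ln y ^ 2 * exp (- y)) + (ln y)\<^sup>2 / y) (at y)"
      using y by (auto intro!: derivative_eq_intros has_real_derivative_log_tail)
    moreover have "- (y powr (-1) * ln y ^ 2 * exp (- y)) + (ln y)\<^sup>2 / y = (ln y)\<^sup>2 / y * (1 - exp (- y))"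
      using y by (simp add: powr_minus field_simps)
    moreover have "\<dots> \<ge> 0" using y by simp
    ultimately show "\<exists>d. ((\<lambda>x. log_tail (-1) 2 x + ln x ^ 3 / 3) has_real_derivative d) (at y) \<and> 0 \<le> d"
      by metis
  qed (use assms in auto)
  thus ?thesis by simp
qed

section \<open>Expansion in the exponent\<close>

text \<open>
  Both bounds come from \<open>u \<le> exp u - 1 \<le> u exp u\<close>, the upper half of which is
  \<open>exp (- u) \<ge> 1 - u\<close>. A factor \<open>1 / 2\<close> in the second bound is given away.
\<close>

lemma exp_Taylor_bounds:
  fixes u M :: real
  assumes "1 \<le> M" "exp u \<le> M"
  shows "\<bar>exp u - 1\<bar> \<le> \<bar>u\<bar> * M" "\<bar>exp u - 1 - u\<bar> \<le> u\<^sup>2 * M"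
proof -
  have lo: "u \<le> exp u - 1" using exp_ge_add_one_self[of u] by linarith
  have "exp u * (1 - u) \<le> exp u * exp (- u)"
    using exp_ge_add_one_self[of "-u"] by (intro mult_left_mono) auto
  hence up: "exp u - 1 \<le> u * exp u" by (simp add: exp_minus algebra_simps)
  show 1: "\<bar>exp u - 1\<bar> \<le> \<bar>u\<bar> * M"
  proof (cases "u \<ge> 0")
    case True
    thus ?thesis using up lo mult_left_mono[OF assms(2), of u] by simp
  next
    case False
    hence "\<bar>exp u - 1\<bar> \<le> - u * 1" using lo by simp
    also have "\<dots> \<le> - u * M" using False assms(1) by (intro mult_left_mono) auto
    finally show ?thesis using False by simp
  qed
  have "exp u - 1 - u \<le> u * (exp u - 1)" using up by (simp add: algebra_simps)
  also have "\<dots> \<le> \<bar>u\<bar> * \<bar>exp u - 1\<bar>" by (simp flip: abs_mult)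
  also have "\<dots> \<le> \<bar>u\<bar> * (\<bar>u\<bar> * M)" by (intro mult_left_mono 1) auto
  also have "\<dots> = u\<^sup>2 * M" by (simp add: power2_eq_square flip: mult.assoc)
  finally show "\<bar>exp u - 1 - u\<bar> \<le> u\<^sup>2 * M" using lo by simp
qed

text \<open>
  The constant \<open>x powr (- s)\<close> does not depend on \<open>t\<close>, so that the bounds can be integrated over
  the half-line \<open>t \<ge> x\<close>.
\<close>

lemma powr_Taylor_bounds:
  fixes s t x :: real
  assumes "0 < x" "x < 1" "x \<le> t" "0 < s"
  shows "\<bar>t powr (- s) - 1\<bar> \<le> s * x powr (- s) * \<bar>ln t\<bar>"
    and "\<bar>t powr (- s) - 1 + s * ln t\<bar> \<le> s\<^sup>2 * x powr (- s) * (ln t)\<^sup>2"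
proof -
  have t: "t > 0" using assms by simp
  have e: "t powr (- s) = exp (- (s * ln t))" using t by (simp add: powr_def)
  have "1 \<le> x powr (- s)" using assms by (simp add: powr_def mult_nonneg_nonpos)
  moreover have "exp (- (s * ln t)) \<le> x powr (- s)"
    using assms unfolding e[symmetric] by (intro powr_mono2') auto
  ultimately show "\<bar>t powr (- s) - 1\<bar> \<le> s * x powr (- s) * \<bar>ln t\<bar>"
    "\<bar>t powr (- s) - 1 + s * ln t\<bar> \<le> s\<^sup>2 * x powr (- s) * (ln t)\<^sup>2"
    using exp_Taylor_bounds[of "x powr (- s)" "- (s * ln t)"] assms
    by (auto simp: e abs_mult power_mult_distrib mult_ac)
qed

lemma tail_abs_le:
  assumes "set_integrable lborel {x..} h" "set_integrable lborel {x..} w"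
    and "\<And>t. t \<ge> x \<Longrightarrow> \<bar>h t\<bar> \<le> w t"
  shows "\<bar>tail h x\<bar> \<le> tail w x"
proof -
  have "norm (tail h x) \<le> (LBINT t:{x..}. norm (h t))"
    unfolding tail_def by (rule set_integral_norm_bound[OF assms(1)])
  also have "\<dots> \<le> tail w x"
    unfolding tail_def using assms by (intro set_integral_mono set_integrable_norm) auto
  finally show ?thesis by simp
qed

lemma log_tail_exponent_expansion:
  fixes s x :: real
  assumes x: "0 < x" "x < 1" and s: "0 < s"
  shows "\<bar>log_tail (- s - 1) 1 x - log_tail (-1) 1 x\<bar> \<le> s * x powr (- s) * log_tail (-1) 2 x"
    and "\<bar>log_tail (- s - 1) 0 x - log_tail (-1) 0 x + s * log_tail (-1) 1 x\<bar>
           \<le> s\<^sup>2 * x powr (- s) * log_tail (-1) 2 x"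
proof -
  define f where "f = (\<lambda>z k t::real. t powr z * ln t ^ k * exp (- t))"
  have int: "set_integrable lborel {x..} (f z k)" if "k \<le> 2" "z \<le> 0" for z k
    unfolding f_def using x that by (intro set_integrable_log_moment)
  have lt: "log_tail z k x = tail (f z k) x" for z k by (simp add: log_tail_def f_def)
  have split: "t powr (- s - 1) = t powr (- 1) * t powr (- s)" if "t \<ge> x" for t
  proof -
    have "- s - 1 = - 1 + - s" by simp
    thus ?thesis by (simp only: powr_add)
  qed
  have mult: "C * log_tail (-1) 2 x = tail (\<lambda>t. C * f (-1) 2 t) x" for C
    by (simp add: lt tail_def)
  have "log_tail (- s - 1) 1 x - log_tail (-1) 1 x = tail (\<lambda>t. f (- s - 1) 1 t - f (-1) 1 t) x"
    using int[of 1] s unfolding lt tail_def by (subst set_integral_diff) auto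
  also have "\<bar>\<dots>\<bar> \<le> s * x powr (- s) * log_tail (-1) 2 x"
    unfolding mult
  proof (rule tail_abs_le)
    fix t assume t: "t \<ge> x"
    have "f (- s - 1) 1 t - f (-1) 1 t = (t powr (- s) - 1) * (t powr (- 1) * ln t * exp (- t))"
      unfolding f_def split[OF t] by (simp add: algebra_simps del: powr_neg_one')
    also have "\<bar>\<dots>\<bar> \<le> (s * x powr (- s) * \<bar>ln t\<bar>) * \<bar>t powr (- 1) * ln t * exp (- t)\<bar>"
      unfolding abs_mult[of "t powr (- s) - 1"]
      using powr_Taylor_bounds(1)[OF x t s] by (intro mult_right_mono) auto
    also have "\<dots> = s * x powr (- s) * f (-1) 2 t"
      by (simp add: f_def abs_mult power2_eq_square mult_ac)
    finally show "\<bar>f (- s - 1) 1 t - f (-1) 1 t\<bar> \<le> s * x powr (- s) * f (-1) 2 t" .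
  qed (use s in \<open>auto intro!: set_integral_diff set_integrable_mult_right int\<close>)
  finally show "\<bar>log_tail (- s - 1) 1 x - log_tail (-1) 1 x\<bar> \<le> s * x powr (- s) * log_tail (-1) 2 x" .
  have "log_tail (- s - 1) 0 x - log_tail (-1) 0 x + s * log_tail (-1) 1 x
          = tail (\<lambda>t. f (- s - 1) 0 t - f (-1) 0 t + s * f (-1) 1 t) x"
    using int[of 0] int[of 1] s unfolding lt tail_def
    by (subst set_integral_add set_integral_diff; (intro set_integral_diff set_integrable_mult_right)?; simp)+
  also have "\<bar>\<dots>\<bar> \<le> s\<^sup>2 * x powr (- s) * log_tail (-1) 2 x"
    unfolding mult
  proof (rule tail_abs_le)
    fix t assume t: "t \<ge> x"
    have "f (- s - 1) 0 t - f (-1) 0 t + s * f (-1) 1 t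
            = (t powr (- s) - 1 + s * ln t) * (t powr (- 1) * exp (- t))"
      unfolding f_def split[OF t] by (simp add: algebra_simps del: powr_neg_one')
    also have "\<bar>\<dots>\<bar> \<le> (s\<^sup>2 * x powr (- s) * (ln t)\<^sup>2) * (t powr (- 1) * exp (- t))"
      unfolding abs_mult[of "t powr (- s) - 1 + s * ln t"]
      using powr_Taylor_bounds(2)[OF x t s] by (auto simp: abs_mult intro!: divide_right_mono mult_right_mono)
    also have "\<dots> = s\<^sup>2 * x powr (- s) * f (-1) 2 t"
      by (simp add: f_def mult_ac)
    finally show "\<bar>f (- s - 1) 0 t - f (-1) 0 t + s * f (-1) 1 t\<bar> \<le> s\<^sup>2 * x powr (- s) * f (-1) 2 t" .
  qed (use s in \<open>auto intro!: set_integral_add set_integral_diff set_integrable_mult_right int\<close>)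
  finally show "\<bar>log_tail (- s - 1) 0 x - log_tail (-1) 0 x + s * log_tail (-1) 1 x\<bar>
           \<le> s\<^sup>2 * x powr (- s) * log_tail (-1) 2 x" .
qed

section \<open>The expansion of the incomplete Gamma function\<close>

lemma upper_incomplete_Gamma_conv_log_tail:
  "upper_incomplete_Gamma (- s) x = log_tail (- s - 1) 0 x"
  by (simp add: upper_incomplete_Gamma_def log_tail_def tail_def)

lemma c1_approx_conv_log_tail: "c1_approx s = log_tail (- s - 1) 1 s + (ln s)\<^sup>2 / 2"
  by (simp add: c1_approx_def log_tail_def tail_def mult_ac)

lemma c1_approx_tendsto:
  "(c1_approx \<longlongrightarrow> (LBINT t:{0<..}. (ln t)\<^sup>2 * exp (- t)) / 2) (at_right 0)"
proof -
  let ?c = "(LBINT t:{0<..}. (ln t)\<^sup>2 * exp (- t)) / 2 :: real"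
  have "((\<lambda>s. c1_approx s - ?c) \<longlongrightarrow> 0) (at_right 0)"
  proof (rule Lim_null_comparison)
    define K where "K = log_tail (-1) 2 1"
    show "((\<lambda>s::real. s * s powr (- s) * (K - ln s ^ 3 / 3) + (s - s * ln s)) \<longlongrightarrow> 0) (at_right 0)"
      by real_asymp
    have "eventually (\<lambda>s::real. s \<in> {0<..<1}) (at_right 0)"
      by (rule eventually_at_right_real) simp
    thus "\<forall>\<^sub>F s in at_right 0. norm (c1_approx s - ?c)
            \<le> s * s powr (- s) * (K - ln s ^ 3 / 3) + (s - s * ln s)"
    proof eventually_elim
      case (elim s)
      hence s: "0 < s" "s < 1" by auto
      have "s * s powr (- s) * log_tail (-1) 2 s \<le> s * s powr (- s) * (K - ln s ^ 3 / 3)"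
        using s log_squared_tail_bound[OF s] by (intro mult_left_mono) (auto simp: K_def)
      thus ?case
        using log_tail_exponent_expansion(1)[OF s s(1)] log_exponential_integral_bound[OF s]
        unfolding c1_approx_conv_log_tail by simp
    qed
  qed
  thus ?thesis by (simp add: LIM_zero_iff)
qed

lemma c1_eq: "c1 = (LBINT t:{0<..}. (ln t)\<^sup>2 * exp (- t)) / 2"
  unfolding c1_def by (rule tendsto_Lim[OF _ c1_approx_tendsto]) simp

text \<open>
  The condition \<open>a s < exp (- 1)\<close> ensures \<open>\<bar>ln (a s)\<bar> \<ge> 1\<close>, so that all error terms can be measured
  against \<open>s^2 \<bar>ln (a s)\<bar>^3\<close>.
\<close>

lemma incomplete_Gamma_error_bound:
  assumes a: "a > 0" and s: "0 < s" and x: "a * s < exp (- 1)" "(a * s) powr (- s) \<le> 2"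
  shows "\<bar>upper_incomplete_Gamma (- s) (a * s)
             - (- ln (a * s) - euler_mascheroni + s * (1 / 2 * (ln (a * s))\<^sup>2 + a - c1))\<bar>
          \<le> (2 * \<bar>log_tail (-1) 2 1\<bar> + 1 + a\<^sup>2 / 2 + 2 * a) * (s\<^sup>2 * \<bar>ln (a * s)\<bar> ^ 3)"
proof -
  define y l where "y = a * s" and "l = \<bar>ln y\<bar>"
  have y0: "y > 0" using a s by (simp add: y_def)
  have y1: "y < 1" using x(1) unfolding y_def by (rule less_trans) simp
  have "ln y < ln (exp (- 1))" using x(1) y0 by (subst ln_less_cancel_iff) (auto simp: y_def)
  hence l: "ln y = - l" "1 \<le> l" by (auto simp: l_def)
  have l3: "1 \<le> l ^ 3" "l \<le> l ^ 3" using l(2) power_increasing[of 1 3 l] by simp_all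
  define K where "K = \<bar>log_tail (-1) 2 1\<bar>"
  define r0 where "r0 = log_tail (- s - 1) 0 y - log_tail (-1) 0 y + s * log_tail (-1) 1 y"
  define r1 where "r1 = log_tail (-1) 0 y + ln y - y + euler_mascheroni"
  define r2 where "r2 = log_tail (-1) 1 y + (ln y)\<^sup>2 / 2 - c1"
  (* the linear term y split off in r1 is the term s * a of the expansion *)
  have D: "upper_incomplete_Gamma (- s) y - (- ln y - euler_mascheroni + s * (1 / 2 * (ln y)\<^sup>2 + a - c1))
      = r0 + r1 - s * r2"
    by (simp add: upper_incomplete_Gamma_conv_log_tail r0_def r1_def r2_def y_def algebra_simps)
  have "log_tail (-1) 2 y \<le> K + l ^ 3 / 3"
    using log_squared_tail_bound[OF y0 y1] l by (simp add: K_def)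
  also have "\<dots> \<le> K * l ^ 3 + l ^ 3 / 2"
    using l3 mult_left_mono[OF l3(1), of K] by (simp add: K_def)
  finally have T: "log_tail (-1) 2 y \<le> (K + 1 / 2) * l ^ 3" by (simp add: algebra_simps)
  have "\<bar>r0\<bar> \<le> s\<^sup>2 * y powr (- s) * log_tail (-1) 2 y"
    unfolding r0_def by (rule log_tail_exponent_expansion(2)[OF y0 y1 s])
  also have "\<dots> \<le> s\<^sup>2 * y powr (- s) * ((K + 1 / 2) * l ^ 3)"
    using T by (intro mult_left_mono) auto
  also have "\<dots> \<le> s\<^sup>2 * 2 * ((K + 1 / 2) * l ^ 3)"
    using x(2) l l3 by (intro mult_right_mono mult_left_mono mult_nonneg_nonneg) (auto simp: y_def K_def)
  finally have 0: "\<bar>r0\<bar> \<le> (2 * K + 1) * (s\<^sup>2 * l ^ 3)" by (simp add: algebra_simps)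
  have "\<bar>r1\<bar> \<le> a\<^sup>2 / 2 * s\<^sup>2 * 1"
    using exponential_integral_bound[OF y0 y1] by (simp add: r1_def y_def power_mult_distrib)
  also have "\<dots> \<le> a\<^sup>2 / 2 * s\<^sup>2 * l ^ 3" using l3 by (intro mult_left_mono) auto
  finally have 1: "\<bar>r1\<bar> \<le> a\<^sup>2 / 2 * (s\<^sup>2 * l ^ 3)" by (simp add: mult_ac)
  have "\<bar>r2\<bar> \<le> y * (1 + l)"
    using log_exponential_integral_bound[OF y0 y1] by (simp add: r2_def c1_eq l algebra_simps)
  also have "\<dots> \<le> y * (2 * l ^ 3)" using l3 y0 by (intro mult_left_mono) auto
  finally have "\<bar>s * r2\<bar> \<le> s * (y * (2 * l ^ 3))" using s by (simp add: abs_mult)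
  also have "\<dots> = 2 * a * (s\<^sup>2 * l ^ 3)" by (simp add: y_def power2_eq_square mult_ac)
  finally have 2: "\<bar>s * r2\<bar> \<le> 2 * a * (s\<^sup>2 * l ^ 3)" .
  have "\<bar>r0 + r1 - s * r2\<bar> \<le> \<bar>r0\<bar> + \<bar>r1\<bar> + \<bar>s * r2\<bar>" by linarith
  also have "\<dots> \<le> (2 * K + 1 + a\<^sup>2 / 2 + 2 * a) * (s\<^sup>2 * l ^ 3)"
    unfolding distrib_right using 0 1 2 unfolding distrib_right by linarith
  finally show ?thesis unfolding D[symmetric] y_def[symmetric] l_def[symmetric] K_def .
qed

theorem mainTheorem16:
  fixes a :: real
  assumes "a > 0"
  shows "(c1_approx \<longlongrightarrow> c1) (at_right 0)
    \<and> (\<lambda>s. upper_incomplete_Gamma (- s) (a * s)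
             - (- ln (a * s) - euler_mascheroni + s * (1 / 2 * (ln (a * s))\<^sup>2 + a - c1)))
        \<in> O[at_right 0](\<lambda>s. s\<^sup>2 * \<bar>ln (a * s)\<bar> ^ 3)"
proof
  show "(c1_approx \<longlongrightarrow> c1) (at_right 0)"
    unfolding c1_eq by (rule c1_approx_tendsto)
  have "((\<lambda>s. (a * s) powr (- s)) \<longlongrightarrow> 1) (at_right 0)"
    using assms by real_asymp
  hence "eventually (\<lambda>s. (a * s) powr (- s) < 2) (at_right 0)"
    by (rule order_tendstoD) simp
  moreover have "((\<lambda>s. a * s) \<longlongrightarrow> 0) (at_right 0)" by real_asymp
  hence "eventually (\<lambda>s. a * s < exp (- 1)) (at_right 0)"
    by (rule order_tendstoD) simp
  ultimately have "eventually (\<lambda>s. norm (upper_incomplete_Gamma (- s) (a * s)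
             - (- ln (a * s) - euler_mascheroni + s * (1 / 2 * (ln (a * s))\<^sup>2 + a - c1)))
        \<le> (2 * \<bar>log_tail (-1) 2 1\<bar> + 1 + a\<^sup>2 / 2 + 2 * a) * norm (s\<^sup>2 * \<bar>ln (a * s)\<bar> ^ 3)) (at_right 0)"
    using eventually_at_right_less[of "0::real"]
    by eventually_elim (use incomplete_Gamma_error_bound[OF assms] in \<open>simp add: abs_mult\<close>)
  thus "(\<lambda>s. upper_incomplete_Gamma (- s) (a * s)
             - (- ln (a * s) - euler_mascheroni + s * (1 / 2 * (ln (a * s))\<^sup>2 + a - c1)))
        \<in> O[at_right 0](\<lambda>s. s\<^sup>2 * \<bar>ln (a * s)\<bar> ^ 3)"
    by (rule bigoI)
qed

end
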